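(* Let $\mathcal{T}=\mathrm{Trian}(A,M,B)$ be a triangular algebra with $M$ faithful, and let $(d_1,d_2,d_3)$ be a triple of linear maps of $\mathcal{T}$ of the form $$d_1\begin{pmatrix}a&m\\&b\end{pmatrix}=\begin{pmatrix}\delta_1(a)&an_1+\tau_1(m)+n_1'b\\&\mu_1(b)\end{pmatrix},$$ $$d_2\begin{pmatrix}a&m\\&b\end{pmatrix}=\begin{pmatrix}\delta_2(a)&an_2+\tau_2(m)+n_1'b\\&\mu_2(b)\end{pmatrix},$$ $$d_3\begin{pmatrix}a&m\\&b\end{pmatrix}=\begin{pmatrix}\delta_3(a)&an_1+\tau_3(m)-n_2b\\&\mu_3(b)\end{pmatrix},$$ where $n_1,n_1',n_2\in M$ and $\delta_i:A\to A$, $\tau_i:M\to M$, $\mu_i:B\to B$ ($i=1,2,3$) are linear maps. Suppose that $\tau_1(am)=\delta_2(a)m+a\tau_3(m)$ and $\tau_1(mb)=m\mu_3(b)+\tau_2(m)b$ for all $a\in A$, $b\in B$, $m\in M$. Then there exist linear maps $\delta_1',\delta_3':A\to A$ and $\mu_1',\mu_2':B\to B$ such that $(\delta_1',\delta_2,\delta_3')$ and $(\mu_1',\mu_2',\mu_3)$ are ternary derivations of $A$ and $B$, respectively. Moreover, the triple $(d_1',d_2',d_3')$ given by $$d_1'\begin{pmatrix}a&m\\&b\end{pmatrix}=\begin{pmatrix}\delta_1'(a)&an_1+\tau_1(m)+n_1'b\\&\mu_1'(b)\end{pmatrix},$$ $$d_2'\begin{pmatrix}a&m\\&b\end{pmatrix}=\begin{pmatrix}\delta_2(a)&an_2+\tau_2(m)+n_1'b\\&\mu_2'(b)\end{pmatrix},$$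 $$d_3'\begin{pmatrix}a&m\\&b\end{pmatrix}=\begin{pmatrix}\delta_3'(a)&an_1+\tau_3(m)-n_2b\\&\mu_3(b)\end{pmatrix}$$ is a ternary derivation of $\mathcal{T}$.
   Context: All algebras are unital and associative over a fixed commutative unital ring $R$. For algebras $A$, $B$ and a nonzero $(A,B)$-bimodule $M$, the triangular algebra $\mathrm{Trian}(A,M,B)$ is the algebra of matrices $\begin{pmatrix}a&m\\&b\end{pmatrix}$ with $a\in A$, $m\in M$, $b\in B$ under the usual matrix operations. $M$ faithful means faithful as a left $A$-module and as a right $B$-module. A triple of $R$-linear maps $(d_1,d_2,d_3)$ of an algebra $\mathcal{A}$ into itself is a ternary derivation of $\mathcal{A}$ if $d_1(xy)=d_2(x)y+xd_3(y)$ for all $x,y\in\mathcal{A}$. *)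

theory Defs
  imports Complex_Main "HOL-Library.Product_Plus"
begin

text \<open>
  Unital associative algebras over a commutative unital ring.  Multiplication and unit are explicit
  parameters rather than class operations, because the multiplication of a triangular algebra
  depends on the two actions on the bimodule and hence is not determined by its type.
\<close>

locale unital_algebra = module scale
  for scale :: "'r::comm_ring_1 \<Rightarrow> 'a::ab_group_add \<Rightarrow> 'a" +
  fixes mult :: "'a \<Rightarrow> 'a \<Rightarrow> 'a"
    and one :: 'a
  assumes mult_assoc: "mult (mult x y) z = mult x (mult y z)"
    and mult_one_left: "mult one x = x"
    and mult_one_right: "mult x one = x"
    and mult_add_left: "mult (x + y) z = mult x z + mult y z"
    and mult_add_right: "mult x (y + z) = mult x y + mult x z"
    and mult_scale_left: "mult (scale r x) y = scale r (mult x y)"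
    and mult_scale_right: "mult x (scale r y) = scale r (mult x y)"

text \<open>
  Linearity over the ground ring is \<open>module_hom\<close>.
\<close>

definition ternary_derivation ::
  "('r::comm_ring_1 \<Rightarrow> 'a::ab_group_add \<Rightarrow> 'a) \<Rightarrow> ('a \<Rightarrow> 'a \<Rightarrow> 'a) \<Rightarrow>
    ('a \<Rightarrow> 'a) \<Rightarrow> ('a \<Rightarrow> 'a) \<Rightarrow> ('a \<Rightarrow> 'a) \<Rightarrow> bool" where
  "ternary_derivation scale mult d1 d2 d3 \<longleftrightarrow>
     module_hom scale scale d1 \<and> module_hom scale scale d2 \<and> module_hom scale scale d3 \<and>
     (\<forall>x y. d1 (mult x y) = mult (d2 x) y + mult x (d3 y))"

text \<open>
  Unital bimodules over two algebras; the ground ring acts in the same way through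
  either algebra and through the module itself.  The class \<open>ring_1\<close> excludes the zero ring, which
  costs nothing below: a unital bimodule over a zero algebra (or over an algebra with zero ground
  ring) is zero, whereas the bimodule of a triangular algebra is nonzero.
\<close>

locale algebra_bimodule =
  A: unital_algebra sA "(*)" 1 + B: unital_algebra sB "(*)" 1 + M: module sM
  for sA :: "'r::comm_ring_1 \<Rightarrow> 'a::ring_1 \<Rightarrow> 'a"
    and sM :: "'r \<Rightarrow> 'm::ab_group_add \<Rightarrow> 'm"
    and sB :: "'r \<Rightarrow> 'b::ring_1 \<Rightarrow> 'b" +
  fixes lact :: "'a \<Rightarrow> 'm \<Rightarrow> 'm"
    and ract :: "'m \<Rightarrow> 'b \<Rightarrow> 'm"
  assumes lact_one: "lact 1 m = m"
    and lact_mult: "lact (a * a') m = lact a (lact a' m)"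
    and lact_add_left: "lact (a + a') m = lact a m + lact a' m"
    and lact_add_right: "lact a (m + m') = lact a m + lact a m'"
    and lact_scale_left: "lact (sA r a) m = sM r (lact a m)"
    and lact_scale_right: "lact a (sM r m) = sM r (lact a m)"
    and ract_one: "ract m 1 = m"
    and ract_mult: "ract m (b * b') = ract (ract m b) b'"
    and ract_add_left: "ract (m + m') b = ract m b + ract m' b"
    and ract_add_right: "ract m (b + b') = ract m b + ract m b'"
    and ract_scale_left: "ract (sM r m) b = sM r (ract m b)"
    and ract_scale_right: "ract m (sB r b) = sM r (ract m b)"
    and lact_ract: "ract (lact a m) b = lact a (ract m b)"

text \<open>
  The upper triangular matrix with diagonal entries \<open>a\<close>, \<open>b\<close> and corner entry \<open>m\<close> is the triple
  \<open>(a, m, b)\<close>.  Addition is the componentwise one of the product type.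
\<close>

type_synonym ('a, 'm, 'b) trian = "'a \<times> 'm \<times> 'b"

fun trian_scale ::
  "('r \<Rightarrow> 'a \<Rightarrow> 'a) \<Rightarrow> ('r \<Rightarrow> 'm \<Rightarrow> 'm) \<Rightarrow> ('r \<Rightarrow> 'b \<Rightarrow> 'b) \<Rightarrow>
    'r \<Rightarrow> ('a, 'm, 'b) trian \<Rightarrow> ('a, 'm, 'b) trian" where
  "trian_scale sA sM sB r (a, m, b) = (sA r a, sM r m, sB r b)"

fun trian_mult ::
  "('a::ring_1 \<Rightarrow> 'm::ab_group_add \<Rightarrow> 'm) \<Rightarrow> ('m \<Rightarrow> 'b::ring_1 \<Rightarrow> 'm) \<Rightarrow>
    ('a, 'm, 'b) trian \<Rightarrow> ('a, 'm, 'b) trian \<Rightarrow> ('a, 'm, 'b) trian" where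
  "trian_mult lact ract (a, m, b) (a', m', b') = (a * a', lact a m' + ract m b', b * b')"

definition trian_one :: "('a::ring_1, 'm::ab_group_add, 'b::ring_1) trian" where
  "trian_one = (1, 0, 1)"

locale triangular_algebra = algebra_bimodule sA sM sB lact ract
  for sA :: "'r::comm_ring_1 \<Rightarrow> 'a::ring_1 \<Rightarrow> 'a"
    and sM :: "'r \<Rightarrow> 'm::ab_group_add \<Rightarrow> 'm"
    and sB :: "'r \<Rightarrow> 'b::ring_1 \<Rightarrow> 'b"
    and lact ract +
  assumes nonzero: "\<exists>m::'m. m \<noteq> 0"

definition faithful_bimodule ::
  "('a::zero \<Rightarrow> 'm::zero \<Rightarrow> 'm) \<Rightarrow> ('m \<Rightarrow> 'b::zero \<Rightarrow> 'm) \<Rightarrow> bool" where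
  "faithful_bimodule lact ract \<longleftrightarrow>
     (\<forall>a. (\<forall>m. lact a m = 0) \<longrightarrow> a = 0) \<and> (\<forall>b. (\<forall>m. ract m b = 0) \<longrightarrow> b = 0)"

context algebra_bimodule
begin

lemma lact_zero_right [simp]: "lact a 0 = 0"
  using lact_add_right[of a 0 0] by simp

lemma ract_zero_left [simp]: "ract 0 b = 0"
  using ract_add_left[of 0 0 b] by simp

lemma trian_unital_algebra:
  "unital_algebra (trian_scale sA sM sB) (trian_mult lact ract) trian_one"
proof
  fix r s :: 'r and x y z :: "('a, 'm, 'b) trian"
  obtain a m b where x: "x = (a, m, b)" by (cases x)
  obtain a' m' b' where y: "y = (a', m', b')" by (cases y)
  obtain a'' m'' b'' where z: "z = (a'', m'', b'')" by (cases z)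
  note defs = x y z trian_one_def
  note laws = A.scale_right_distrib B.scale_right_distrib M.scale_right_distrib
    A.scale_left_distrib B.scale_left_distrib M.scale_left_distrib
    A.mult_scale_left A.mult_scale_right B.mult_scale_left B.mult_scale_right
    lact_one lact_mult lact_add_left lact_add_right lact_scale_left lact_scale_right
    ract_one ract_mult ract_add_left ract_add_right ract_scale_left ract_scale_right lact_ract
  show "trian_scale sA sM sB r (x + y) = trian_scale sA sM sB r x + trian_scale sA sM sB r y"
    by (simp add: defs laws)
  show "trian_scale sA sM sB (r + s) x = trian_scale sA sM sB r x + trian_scale sA sM sB s x"
    by (simp add: defs laws)
  show "trian_scale sA sM sB r (trian_scale sA sM sB s x) = trian_scale sA sM sB (r * s) x"
    by (simp add: defs)
  show "trian_scale sA sM sB 1 x = x"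
    by (simp add: defs)
  show "trian_mult lact ract (trian_mult lact ract x y) z
      = trian_mult lact ract x (trian_mult lact ract y z)"
    by (simp add: defs laws algebra_simps)
  show "trian_mult lact ract trian_one x = x" "trian_mult lact ract x trian_one = x"
    by (simp_all add: defs laws)
  show "trian_mult lact ract (x + y) z = trian_mult lact ract x z + trian_mult lact ract y z"
    by (simp add: defs laws algebra_simps)
  show "trian_mult lact ract x (y + z) = trian_mult lact ract x y + trian_mult lact ract x z"
    by (simp add: defs laws algebra_simps)
  show "trian_mult lact ract (trian_scale sA sM sB r x) y
      = trian_scale sA sM sB r (trian_mult lact ract x y)"
    by (simp add: defs laws)
  show "trian_mult lact ract x (trian_scale sA sM sB r y)
      = trian_scale sA sM sB r (trian_mult lact ract x y)"
    by (simp add: defs laws)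
qed

end

end

theory Submission
  imports Defs
begin

text \<open>
  Putting \<open>a = 1\<close> in \<open>\<tau>1 (a m) = \<delta>2 a m + a \<tau>3 m\<close> gives \<open>\<tau>3 m = \<tau>1 m - p m\<close> with \<open>p = \<delta>2 1\<close>, so
  that \<open>\<tau>1\<close> satisfies the Leibniz rule \<open>\<tau>1 (a m) = D a m + a \<tau>1 m\<close> for \<open>D a = \<delta>2 a - a p\<close>.  Expanding
  \<open>\<tau>1 (x y m)\<close> in two ways shows that \<open>D (x y) - D x y - x D y\<close> annihilates \<open>M\<close>, and hence \<open>D\<close> is a
  derivation of \<open>A\<close> by faithfulness (\<open>derivation_if_left_Leibniz\<close>).  On the right side the same
  argument with \<open>q = \<mu>3 1\<close> yields the derivation \<open>E b = \<mu>3 b - q b\<close> of \<open>B\<close>.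

  A derivation \<open>D\<close> and an element \<open>c\<close> always form the ternary derivation
  \<open>(D, x \<mapsto> D x + x c, x \<mapsto> D x - c x)\<close> (\<open>ternary_derivation_of_derivation\<close>).  For \<open>A\<close> the choice
  \<open>c = p\<close> makes the middle map equal to \<open>\<delta>2\<close>; for \<open>B\<close> the choice \<open>c = - q\<close> makes the last map equal
  to \<open>\<mu>3\<close>.

  In the ternary derivation identity on the triangular algebra, the two diagonal entries involve only
  the maps on \<open>A\<close> and \<open>B\<close>, and the corner entry involves, of these maps, only \<open>\<delta>2\<close> and \<open>\<mu>3\<close>.  Hence the
  other four may be replaced by any maps that complete \<open>\<delta>2\<close> and \<open>\<mu>3\<close> to ternary derivations
  (\<open>ternary_derivation_trian\<close>).
\<close>

context unital_algebra
begin

lemma mult_minus_right: "mult x (- y) = - mult x y"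
  using mult_add_right[of x y "- y"] mult_add_right[of x 0 0]
  by (simp add: add_eq_0_iff)

lemma mult_diff_right: "mult x (y - z) = mult x y - mult x z"
  using mult_add_right[of x y "- z"] by (simp add: mult_minus_right)

text \<open>
  The contributions \<open>x c y\<close> of the two perturbations cancel.
\<close>

lemma ternary_derivation_of_derivation:
  assumes lin: "module_hom scale scale D"
    and deriv: "\<And>x y. D (mult x y) = mult (D x) y + mult x (D y)"
  shows "ternary_derivation scale mult D (\<lambda>x. D x + mult x c) (\<lambda>x. D x - mult c x)"
proof -
  interpret D: module_hom scale scale D by (rule lin)
  have "module_hom scale scale (\<lambda>x. D x + mult x c)" "module_hom scale scale (\<lambda>x. D x - mult c x)"
    by unfold_locales
      (simp_all add: D.add D.scale mult_add_left mult_add_right mult_scale_left mult_scale_right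
        scale_right_distrib scale_right_diff_distrib algebra_simps)
  moreover have "D (mult x y) = mult (D x + mult x c) y + mult x (D y - mult c y)" for x y
    by (simp add: deriv mult_add_left mult_diff_right mult_assoc)
  ultimately show ?thesis
    using lin by (simp add: ternary_derivation_def)
qed

end

context algebra_bimodule
begin

lemma lact_minus_left: "lact (- a) m = - lact a m"
  using lact_add_left[of a "- a" m] lact_add_left[of 0 0 m]
  by (simp add: add_eq_0_iff)

lemma lact_minus_right: "lact a (- m) = - lact a m"
  using lact_add_right[of a m "- m"] by (simp add: add_eq_0_iff)

lemma ract_minus_left: "ract (- m) b = - ract m b"
  using ract_add_left[of m "- m" b] by (simp add: add_eq_0_iff)

lemma ract_minus_right: "ract m (- b) = - ract m b"
  using ract_add_right[of m b "- b"] ract_add_right[of m 0 0]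
  by (simp add: add_eq_0_iff)

lemma lact_diff_left: "lact (a - a') m = lact a m - lact a' m"
  using lact_add_left[of a "- a'" m] by (simp add: lact_minus_left)

lemma lact_diff_right: "lact a (m - m') = lact a m - lact a m'"
  using lact_add_right[of a m "- m'"] by (simp add: lact_minus_right)

lemma ract_diff_left: "ract (m - m') b = ract m b - ract m' b"
  using ract_add_left[of m "- m'" b] by (simp add: ract_minus_left)

lemma ract_diff_right: "ract m (b - b') = ract m b - ract m b'"
  using ract_add_right[of m b "- b'"] by (simp add: ract_minus_right)

text \<open>
  Since \<open>(x y) m = x (y m)\<close>, the Leibniz rule computes \<open>\<tau>\<close> at this element in two ways.  The
  two results differ by the action on \<open>m\<close> of the defect \<open>D (x y) - (D x y + x D y)\<close>.
\<close>

lemma derivation_if_left_Leibniz: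
  assumes faithful: "faithful_bimodule lact ract"
    and Leibniz: "\<And>a m. \<tau> (lact a m) = lact (D a) m + lact a (\<tau> m)"
  shows "D (x * y) = D x * y + x * D y"
proof -
  have "lact (D (x * y) - (D x * y + x * D y)) m = 0" for m
    using Leibniz[of "x * y" m]
    by (simp add: lact_diff_left lact_add_left lact_add_right lact_mult Leibniz algebra_simps)
  with faithful have "D (x * y) - (D x * y + x * D y) = 0"
    unfolding faithful_bimodule_def by blast
  then show ?thesis by simp
qed

lemma derivation_if_right_Leibniz:
  assumes faithful: "faithful_bimodule lact ract"
    and Leibniz: "\<And>m b. \<tau> (ract m b) = ract m (E b) + ract (\<tau> m) b"
  shows "E (x * y) = E x * y + x * E y"
proof -
  have "ract m (E (x * y) - (E x * y + x * E y)) = 0" for m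
    using Leibniz[of m "x * y"]
    by (simp add: ract_diff_right ract_add_left ract_add_right ract_mult Leibniz algebra_simps)
  with faithful have "E (x * y) - (E x * y + x * E y) = 0"
    unfolding faithful_bimodule_def by blast
  then show ?thesis by simp
qed

lemma module_hom_trian:
  assumes "module_hom sA sA \<delta>" "module_hom sM sM \<tau>" "module_hom sB sB \<mu>"
  shows "module_hom (trian_scale sA sM sB) (trian_scale sA sM sB)
    (\<lambda>(a, m, b). (\<delta> a, lact a n + \<tau> m + ract n' b, \<mu> b))"
proof -
  interpret \<delta>: module_hom sA sA \<delta> by fact
  interpret \<tau>: module_hom sM sM \<tau> by fact
  interpret \<mu>: module_hom sB sB \<mu> by fact
  interpret T: unital_algebra "trian_scale sA sM sB" "trian_mult lact ract" trian_one
    by (rule trian_unital_algebra)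
  show ?thesis
    by unfold_locales
      (auto simp: \<delta>.add \<delta>.scale \<tau>.add \<tau>.scale \<mu>.add \<mu>.scale M.scale_right_distrib
        lact_add_left lact_scale_left ract_add_right ract_scale_right algebra_simps)
qed

text \<open>
  In the corner entry of the product rule the terms with \<open>n2\<close>, namely \<open>(a n2) b'\<close> from \<open>d2\<close> and
  \<open>- a (n2 b')\<close> from \<open>d3\<close>, cancel; those with \<open>n1\<close> and \<open>n1'\<close> match by associativity, and the rest are
  the two compatibility conditions on the \<open>\<tau>\<close>s.
\<close>

lemma ternary_derivation_trian:
  assumes \<delta>: "ternary_derivation sA (*) \<delta>1 \<delta>2 \<delta>3"
    and \<mu>: "ternary_derivation sB (*) \<mu>1 \<mu>2 \<mu>3"
    and \<tau>: "module_hom sM sM \<tau>1" "module_hom sM sM \<tau>2" "module_hom sM sM \<tau>3"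
    and \<tau>1_left: "\<And>a m. \<tau>1 (lact a m) = lact (\<delta>2 a) m + lact a (\<tau>3 m)"
    and \<tau>1_right: "\<And>m b. \<tau>1 (ract m b) = ract m (\<mu>3 b) + ract (\<tau>2 m) b"
  shows "ternary_derivation (trian_scale sA sM sB) (trian_mult lact ract)
    (\<lambda>(a, m, b). (\<delta>1 a, lact a n1 + \<tau>1 m + ract n1' b, \<mu>1 b))
    (\<lambda>(a, m, b). (\<delta>2 a, lact a n2 + \<tau>2 m + ract n1' b, \<mu>2 b))
    (\<lambda>(a, m, b). (\<delta>3 a, lact a n1 + \<tau>3 m - ract n2 b, \<mu>3 b))"
    (is "ternary_derivation ?s ?mult ?d1 ?d2 ?d3")
proof -
  have lin: "module_hom sA sA \<delta>1" "module_hom sA sA \<delta>2" "module_hom sA sA \<delta>3"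
    "module_hom sB sB \<mu>1" "module_hom sB sB \<mu>2" "module_hom sB sB \<mu>3"
    and prod: "\<And>x y. \<delta>1 (x * y) = \<delta>2 x * y + x * \<delta>3 y" "\<And>x y. \<mu>1 (x * y) = \<mu>2 x * y + x * \<mu>3 y"
    using \<delta> \<mu> by (auto simp: ternary_derivation_def)
  have "module_hom ?s ?s ?d1" "module_hom ?s ?s ?d2"
    using lin \<tau> by (auto intro: module_hom_trian)
  moreover have "module_hom ?s ?s ?d3"
    using module_hom_trian[OF lin(3) \<tau>(3) lin(6), of n1 "- n2"]
    by (simp add: ract_minus_left)
  moreover have "?d1 (?mult x y) = ?mult (?d2 x) y + ?mult x (?d3 y)" for x y
    by (cases x; cases y)
      (simp add: prod module_hom.add[OF \<tau>(1)] \<tau>1_left \<tau>1_right lact_mult ract_mult lact_ract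
        lact_add_right lact_diff_right ract_add_left)
  ultimately show ?thesis
    by (simp add: ternary_derivation_def)
qed

end

theorem theorem4p15:
  fixes sA :: "'r::comm_ring_1 \<Rightarrow> 'a::ring_1 \<Rightarrow> 'a"
    and sM :: "'r \<Rightarrow> 'm::ab_group_add \<Rightarrow> 'm"
    and sB :: "'r \<Rightarrow> 'b::ring_1 \<Rightarrow> 'b"
    and lact :: "'a \<Rightarrow> 'm \<Rightarrow> 'm"  (infixr "\<rhd>" 75)
    and ract :: "'m \<Rightarrow> 'b \<Rightarrow> 'm"  (infixl "\<lhd>" 75)
    and d1 d2 d3 :: "('a, 'm, 'b) trian \<Rightarrow> ('a, 'm, 'b) trian"
    and \<delta>1 \<delta>2 \<delta>3 :: "'a \<Rightarrow> 'a"
    and \<tau>1 \<tau>2 \<tau>3 :: "'m \<Rightarrow> 'm"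
    and \<mu>1 \<mu>2 \<mu>3 :: "'b \<Rightarrow> 'b"
    and n1 n1' n2 :: 'm
  assumes trian: "triangular_algebra sA sM sB lact ract"
    and faithful: "faithful_bimodule lact ract"
    and lin_d: "module_hom (trian_scale sA sM sB) (trian_scale sA sM sB) d1"
      "module_hom (trian_scale sA sM sB) (trian_scale sA sM sB) d2"
      "module_hom (trian_scale sA sM sB) (trian_scale sA sM sB) d3"
    and lin_\<delta>: "module_hom sA sA \<delta>1" "module_hom sA sA \<delta>2" "module_hom sA sA \<delta>3"
    and lin_\<tau>: "module_hom sM sM \<tau>1" "module_hom sM sM \<tau>2" "module_hom sM sM \<tau>3"
    and lin_\<mu>: "module_hom sB sB \<mu>1" "module_hom sB sB \<mu>2" "module_hom sB sB \<mu>3"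
    and d1: "\<And>a m b. d1 (a, m, b) = (\<delta>1 a, a \<rhd> n1 + \<tau>1 m + n1' \<lhd> b, \<mu>1 b)"
    and d2: "\<And>a m b. d2 (a, m, b) = (\<delta>2 a, a \<rhd> n2 + \<tau>2 m + n1' \<lhd> b, \<mu>2 b)"
    and d3: "\<And>a m b. d3 (a, m, b) = (\<delta>3 a, a \<rhd> n1 + \<tau>3 m - n2 \<lhd> b, \<mu>3 b)"
    and \<tau>1_left: "\<And>a m. \<tau>1 (a \<rhd> m) = \<delta>2 a \<rhd> m + a \<rhd> \<tau>3 m"
    and \<tau>1_right: "\<And>m b. \<tau>1 (m \<lhd> b) = m \<lhd> \<mu>3 b + \<tau>2 m \<lhd> b"
  shows "\<exists>\<delta>1' \<delta>3' \<mu>1' \<mu>2'.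
      module_hom sA sA \<delta>1' \<and> module_hom sA sA \<delta>3' \<and>
      module_hom sB sB \<mu>1' \<and> module_hom sB sB \<mu>2' \<and>
      ternary_derivation sA (*) \<delta>1' \<delta>2 \<delta>3' \<and>
      ternary_derivation sB (*) \<mu>1' \<mu>2' \<mu>3 \<and>
      ternary_derivation (trian_scale sA sM sB) (trian_mult lact ract)
        (\<lambda>(a, m, b). (\<delta>1' a, a \<rhd> n1 + \<tau>1 m + n1' \<lhd> b, \<mu>1' b))
        (\<lambda>(a, m, b). (\<delta>2 a, a \<rhd> n2 + \<tau>2 m + n1' \<lhd> b, \<mu>2' b))
        (\<lambda>(a, m, b). (\<delta>3' a, a \<rhd> n1 + \<tau>3 m - n2 \<lhd> b, \<mu>3 b))"
proof -
  interpret triangular_algebra sA sM sB lact ract by (rule trian)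
  interpret \<delta>2: module_hom sA sA \<delta>2 by (rule lin_\<delta>)
  interpret \<mu>3: module_hom sB sB \<mu>3 by (rule lin_\<mu>)
  define p where "p = \<delta>2 1"
  define q where "q = \<mu>3 1"
  define D where "D a = \<delta>2 a - a * p" for a
  define E where "E b = \<mu>3 b - q * b" for b

  have lin: "module_hom sA sA D" "module_hom sB sB E"
    by unfold_locales
      (simp_all add: D_def E_def \<delta>2.add \<delta>2.scale \<mu>3.add \<mu>3.scale A.scale_right_diff_distrib
        B.scale_right_diff_distrib A.mult_scale_left B.mult_scale_right algebra_simps)

  have \<tau>3: "\<tau>3 m = \<tau>1 m - p \<rhd> m" for m
    using \<tau>1_left[of 1 m] by (simp add: p_def lact_one)
  have "\<tau>1 (a \<rhd> m) = D a \<rhd> m + a \<rhd> \<tau>1 m" for a m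
    by (simp add: \<tau>1_left D_def \<tau>3 lact_diff_left lact_diff_right lact_mult)
  then have "D (x * y) = D x * y + x * D y" for x y
    by (rule derivation_if_left_Leibniz[OF faithful])
  from A.ternary_derivation_of_derivation[OF lin(1) this, of p]
  have ternary_A: "ternary_derivation sA (*) D \<delta>2 (\<lambda>a. D a - p * a)"
    by (simp add: D_def[abs_def])

  have \<tau>2: "\<tau>2 m = \<tau>1 m - m \<lhd> q" for m
    using \<tau>1_right[of m 1] by (simp add: q_def ract_one)
  have "\<tau>1 (m \<lhd> b) = m \<lhd> E b + \<tau>1 m \<lhd> b" for m b
    by (simp add: \<tau>1_right E_def \<tau>2 ract_diff_left ract_diff_right ract_mult)
  then have "E (x * y) = E x * y + x * E y" for x y
    by (rule derivation_if_right_Leibniz[OF faithful])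
  from B.ternary_derivation_of_derivation[OF lin(2) this, of "- q"]
  have ternary_B: "ternary_derivation sB (*) E (\<lambda>b. E b - b * q) \<mu>3"
    by (simp add: E_def[abs_def])

  have "module_hom sA sA (\<lambda>a. D a - p * a)" "module_hom sB sB (\<lambda>b. E b - b * q)"
    using ternary_A ternary_B by (simp_all add: ternary_derivation_def)
  with lin ternary_A ternary_B
    ternary_derivation_trian[OF ternary_A ternary_B lin_\<tau> \<tau>1_left \<tau>1_right]
  show ?thesis by blast
qed

end
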